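(* Let $k\ge 1$, let $x\in S_{2k}$ be the $2k$-cycle $(0\ 1\ 2\ \dots\ 2k-1)$, and let $p$ be a positive divisor of $2k$. Let $\nu_p$ be the number of one-vertex maps with $k$ edges whose full automorphism group is $\langle x^p\rangle$. Then the number of equivalence classes of one-vertex maps with $k$ edges whose full automorphism group is $\langle x^p\rangle$ is $\nu_p/p$.
   Context: A free involution in $S_{2k}$ is a fixed-point-free involution. A map is a finite connected graph (loops and multiple edges allowed) embedded on a compact oriented surface with simply connected complementary faces; each edge carries two darts (directed edges). With $k$ edges and darts labelled $0,\dots,2k-1$, it is encoded by $x\in S_{2k}$, the product over the vertices of the cycles giving the counterclockwise order of the darts pointing to each vertex, and the free involution $y\in S_{2k}$ interchanging the two darts on each edge; its monodromy group is $\langle x,y\rangle$. For a one-vertex map, $x$ is a $2k$-cycle and, up to relabelling, is taken to be the standard cycle $(0\ 1\ \dots\ 2k-1)$; one-vertex maps with $k$ edges are then counted as the free involutions $y\in S_{2k}$. The (full) automorphism group of the map is the centralizer of $\langle x,y\rangle$ in $S_{2k}$; it is a subgroup of $\langle x\rangle$. So $\nu_p$ is the number of free involutions $y$ for which this centralizer equals $\langle x^p\rangle$. Two maps with monodromy generators $(x_1,y_1)$ and $(x_2,y_2)$ in $S_{2k}$ are equivalent if some $\sigma\in S_{2k}$ satisfies $\sigma^{-1}x_1\sigma=x_2$ and $\sigma^{-1}y_1\sigma=y_2$. *)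

theory Defs
  imports "HOL-Algebra.Algebra"
begin

abbreviation darts :: "nat \<Rightarrow> nat set"
  where "darts k \<equiv> {0..<2 * k}"

(* The library's sym_group acts on {1..n}; darts are labelled from 0. *)
definition dart_group :: "nat \<Rightarrow> (nat \<Rightarrow> nat) monoid"
  where "dart_group k = \<lparr>carrier = {f. f permutes darts k}, monoid.mult = (\<circ>), one = id\<rparr>"

definition free_involution :: "nat \<Rightarrow> (nat \<Rightarrow> nat) \<Rightarrow> bool"
  where "free_involution k y \<longleftrightarrow>
    y \<in> carrier (dart_group k) \<and> y \<circ> y = id \<and> (\<forall>i\<in>darts k. y i \<noteq> i)"

definition group_centralizer :: "('a, 'b) monoid_scheme \<Rightarrow> 'a set \<Rightarrow> 'a set"
  where "group_centralizer G H = {g \<in> carrier G. \<forall>h\<in>H. g \<otimes>\<^bsub>G\<^esub> h = h \<otimes>\<^bsub>G\<^esub> g}"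

definition monodromy_group :: "nat \<Rightarrow> (nat \<Rightarrow> nat) \<times> (nat \<Rightarrow> nat) \<Rightarrow> (nat \<Rightarrow> nat) set"
  where "monodromy_group k m = generate (dart_group k) {fst m, snd m}"

definition map_automorphisms :: "nat \<Rightarrow> (nat \<Rightarrow> nat) \<times> (nat \<Rightarrow> nat) \<Rightarrow> (nat \<Rightarrow> nat) set"
  where "map_automorphisms k m = group_centralizer (dart_group k) (monodromy_group k m)"

(* Maps with k edges on labelled darts, encoded by their monodromy generators (x, y): the
   vertices are the cycles of x and the edges the cycles of y.  Connectedness of the underlying
   graph is transitivity of the monodromy group on the darts. *)
definition edge_maps :: "nat \<Rightarrow> ((nat \<Rightarrow> nat) \<times> (nat \<Rightarrow> nat)) set"
  where "edge_maps k = {m.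
    fst m \<in> carrier (dart_group k) \<and> free_involution k (snd m) \<and>
    (\<forall>i\<in>darts k. \<forall>j\<in>darts k. \<exists>g\<in>monodromy_group k m. g i = j)}"

definition map_equiv ::
    "nat \<Rightarrow> (((nat \<Rightarrow> nat) \<times> (nat \<Rightarrow> nat)) \<times> ((nat \<Rightarrow> nat) \<times> (nat \<Rightarrow> nat))) set"
  where "map_equiv k = {(m1, m2). m1 \<in> edge_maps k \<and> m2 \<in> edge_maps k \<and>
    (\<exists>s\<in>carrier (dart_group k).
      inv\<^bsub>dart_group k\<^esub> s \<otimes>\<^bsub>dart_group k\<^esub> fst m1 \<otimes>\<^bsub>dart_group k\<^esub> s = fst m2 \<and>
      inv\<^bsub>dart_group k\<^esub> s \<otimes>\<^bsub>dart_group k\<^esub> snd m1 \<otimes>\<^bsub>dart_group k\<^esub> s = snd m2)}"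

definition std_cycle :: "nat \<Rightarrow> nat \<Rightarrow> nat"
  where "std_cycle k = cycle_of_list [0..<2 * k]"

(* One-vertex maps are taken with darts labelled so that the vertex is the standard cycle. *)
definition one_vertex_maps :: "nat \<Rightarrow> ((nat \<Rightarrow> nat) \<times> (nat \<Rightarrow> nat)) set"
  where "one_vertex_maps k = {m \<in> edge_maps k. fst m = std_cycle k}"

definition one_vertex_maps_aut :: "nat \<Rightarrow> nat \<Rightarrow> ((nat \<Rightarrow> nat) \<times> (nat \<Rightarrow> nat)) set"
  where "one_vertex_maps_aut k p = {m \<in> one_vertex_maps k.
    map_automorphisms k m = generate (dart_group k) {std_cycle k [^]\<^bsub>dart_group k\<^esub> p}}"

definition nu :: "nat \<Rightarrow> nat \<Rightarrow> nat"
  where "nu k p = card (one_vertex_maps_aut k p)"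

lemma std_cycle_permutes: "std_cycle k permutes darts k"
  using cycle_permutes[of "[0..<2 * k]"] by (simp add: std_cycle_def)

lemma std_cycle_funpow_apply:
  assumes "i < 2 * k"
  shows "(std_cycle k ^^ n) i = (i + n) mod (2 * k)"
proof -
  have "map (std_cycle k ^^ n) [0..<2 * k] = rotate n [0..<2 * k]"
    unfolding std_cycle_def by (rule cyclic_rotation) simp
  hence "map (std_cycle k ^^ n) [0..<2 * k] ! i = rotate n [0..<2 * k] ! i"
    by simp
  thus ?thesis
    using assms by (simp add: nth_rotate add.commute)
qed

lemma std_cycle_apply:
  assumes "i < 2 * k"
  shows "std_cycle k i = (i + 1) mod (2 * k)"
  using std_cycle_funpow_apply[OF assms, of 1] by simp

lemma one_vertex_maps_eq:
  "one_vertex_maps k = {std_cycle k} \<times> {y. free_involution k y}"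
proof -
  have pow: "std_cycle k ^^ n \<in> generate (dart_group k) {std_cycle k, y}" for n y
  proof (induction n)
    case 0
    show ?case
      using generate.one[of "dart_group k"] by (simp add: dart_group_def id_def)
  next
    case (Suc n)
    have "std_cycle k \<in> generate (dart_group k) {std_cycle k, y}"
      by (rule generate.incl) simp
    from generate.eng[OF this Suc] show ?case
      by (simp add: dart_group_def comp_def)
  qed
  have "\<exists>g\<in>monodromy_group k (std_cycle k, y). g i = j"
    if "i < 2 * k" "j < 2 * k" for i j y
  proof (rule bexI[of _ "std_cycle k ^^ (2 * k - i + j)"])
    show "(std_cycle k ^^ (2 * k - i + j)) i = j"
      using that by (simp add: std_cycle_funpow_apply)
    show "std_cycle k ^^ (2 * k - i + j) \<in> monodromy_group k (std_cycle k, y)"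
      using pow by (simp add: monodromy_group_def)
  qed
  thus ?thesis
    using std_cycle_permutes[of k]
    by (auto simp: one_vertex_maps_def edge_maps_def dart_group_def)
qed

end

(* By transitivity of its powers, the standard cycle c generates its own centralizer, so equivalent
   one-vertex maps (c, y), (c, y') are conjugate by a power of c.  Such a conjugation does not change
   the automorphism group, and c^n, c^m conjugate y to the same involution iff c^(m - n) is an
   automorphism, that is, iff p divides m - n.  Every class therefore meets the set of maps
   under consideration in exactly p elements. *)

theory Submission
  imports Defs
begin

section \<open>Counting the classes that meet a subset\<close>

lemma card_eq_mult_card_quotient:
  assumes "equiv B R" "A \<subseteq> B" "finite A" "\<And>a. a \<in> A \<Longrightarrow> card (R `` {a} \<inter> A) = n"
  shows "card A = n * card (A // R)"
proof -
  \<comment> \<open>\<open>A\<close> may cut through classes, so the fibre over a class is only its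
    trace on \<open>A\<close>. Summing the fibre sizes over the classes met by \<open>A\<close>
    counts each element once.\<close>
  have fibre: "{b \<in> A. R `` {b} = R `` {a}} = R `` {a} \<inter> A" if "a \<in> A" for a
    using eq_equiv_class_iff[OF assms(1)] assms(2) that by blast
  have "card A = (\<Sum>C\<in>(\<lambda>a. R `` {a}) ` A. card {b \<in> A. R `` {b} = C})"
    using sum.image_gen[OF assms(3), of "\<lambda>_. 1::nat" "\<lambda>a. R `` {a}"] by simp
  also have "\<dots> = (\<Sum>C\<in>(\<lambda>a. R `` {a}) ` A. n)"
    by (rule sum.cong) (auto simp: fibre assms(4))
  also have "(\<lambda>a. R `` {a}) ` A = A // R"
    by (auto simp: quotient_def)
  finally show ?thesis
    by simp
qed

section \<open>Conjugation and centralizers in an arbitrary group\<close>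

context group
begin

text \<open>Turns collisions between conjugates of \<open>y\<close> into membership of a quotient of
  the conjugators in the centralizer of \<open>y\<close>. This is how automorphisms enter the
  count.\<close>

lemma conjugate_eq_iff:
  assumes [simp]: "s \<in> carrier G" "t \<in> carrier G" "y \<in> carrier G"
  shows "inv s \<otimes> y \<otimes> s = inv t \<otimes> y \<otimes> t \<longleftrightarrow> (t \<otimes> inv s) \<otimes> y = y \<otimes> (t \<otimes> inv s)"
proof -
  have "inv s \<otimes> y \<otimes> s = inv t \<otimes> y \<otimes> t \<longleftrightarrow> y \<otimes> t = t \<otimes> (inv s \<otimes> (y \<otimes> s))"
    by (simp add: m_assoc inv_solve_left)
  also have "\<dots> \<longleftrightarrow> y \<otimes> t = (t \<otimes> inv s \<otimes> y) \<otimes> s"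
    by (simp add: m_assoc)
  also have "\<dots> \<longleftrightarrow> (y \<otimes> t) \<otimes> inv s = t \<otimes> inv s \<otimes> y"
    by (rule inv_solve_right'[symmetric]) simp_all
  finally show ?thesis
    by (auto simp: m_assoc)
qed

lemma commutes_inv:
  assumes [simp]: "g \<in> carrier G" "h \<in> carrier G" and comm: "g \<otimes> h = h \<otimes> g"
  shows "g \<otimes> inv h = inv h \<otimes> g"
proof -
  have "h \<otimes> (g \<otimes> inv h) = (g \<otimes> h) \<otimes> inv h"
    by (simp add: comm m_assoc)
  also have "\<dots> = g"
    by (simp add: m_assoc)
  finally show ?thesis
    by (simp add: inv_solve_left)
qed

lemma commutes_mult:
  assumes [simp]: "g \<in> carrier G" "a \<in> carrier G" "b \<in> carrier G"
    and ga: "g \<otimes> a = a \<otimes> g" and gb: "g \<otimes> b = b \<otimes> g"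
  shows "g \<otimes> (a \<otimes> b) = (a \<otimes> b) \<otimes> g"
proof -
  have "g \<otimes> (a \<otimes> b) = a \<otimes> (g \<otimes> b)"
    by (simp add: m_assoc[symmetric] ga)
  then show ?thesis
    by (simp add: gb m_assoc)
qed

lemma commutes_generate:
  assumes "g \<in> carrier G" "H \<subseteq> carrier G" "\<And>h. h \<in> H \<Longrightarrow> g \<otimes> h = h \<otimes> g" "a \<in> generate G H"
  shows "g \<otimes> a = a \<otimes> g"
  using assms(4)
proof (induction rule: generate.induct)
  case one
  then show ?case using assms(1) by simp
next
  case (incl h)
  then show ?case by (rule assms(3))
next
  case (inv h)
  then show ?case using assms commutes_inv by blast
next
  case (eng a b)
  then show ?case
    using commutes_mult generate_in_carrier[OF assms(2)] assms(1) by blast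
qed

text \<open>Commutation passes from generators to inverses and products; the other inclusion holds
  because a larger set has a smaller centralizer. Automorphisms of a map can thus be tested on its
  two monodromy generators.\<close>

lemma group_centralizer_generate:
  assumes "H \<subseteq> carrier G"
  shows "group_centralizer G (generate G H) = group_centralizer G H"
proof
  show "group_centralizer G H \<subseteq> group_centralizer G (generate G H)"
    using commutes_generate[OF _ assms] by (auto simp: group_centralizer_def)
qed (auto simp: group_centralizer_def intro: generate.incl)

text \<open>An element commuting with \<open>c\<close> commutes with \<open>s\<close>, which is a
  power of \<open>c\<close>. It therefore commutes with every factor of the conjugate.\<close>

lemma group_centralizer_conjugate_le:
  assumes "c \<in> carrier G" "y \<in> carrier G" "s \<in> generate G {c}"
  shows "group_centralizer G {c, y} \<subseteq> group_centralizer G {c, inv s \<otimes> y \<otimes> s}"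
proof
  fix g assume g: "g \<in> group_centralizer G {c, y}"
  have s: "s \<in> carrier G"
    using assms generate_in_carrier[of "{c}"] by auto
  have "g \<otimes> s = s \<otimes> g"
    using commutes_generate[of g "{c}" s] g assms by (auto simp: group_centralizer_def)
  with g s assms show "g \<in> group_centralizer G {c, inv s \<otimes> y \<otimes> s}"
    by (auto simp: group_centralizer_def intro!: commutes_mult commutes_inv)
qed

lemma group_centralizer_conjugate:
  assumes "c \<in> carrier G" "y \<in> carrier G" "s \<in> generate G {c}"
  shows "group_centralizer G {c, inv s \<otimes> y \<otimes> s} = group_centralizer G {c, y}"
proof
  have s: "s \<in> carrier G" "inv s \<in> generate G {c}"
    using assms generate_in_carrier[of "{c}"] generate_m_inv_closed[of "{c}"] by auto
  \<comment> \<open>Conjugating back by \<open>inv s\<close>, again a power of \<open>c\<close>,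
    recovers \<open>y\<close>. The inclusion already proved, applied to the conjugate, then gives
    the reverse one.\<close>
  have "inv (inv s) \<otimes> (inv s \<otimes> y \<otimes> s) \<otimes> inv s = y"
    using assms s by (simp add: m_assoc) (simp add: m_assoc[symmetric])
  with group_centralizer_conjugate_le[OF assms(1) _ s(2), of "inv s \<otimes> y \<otimes> s"]
  show "group_centralizer G {c, inv s \<otimes> y \<otimes> s} \<subseteq> group_centralizer G {c, y}"
    using assms s by simp
qed (rule group_centralizer_conjugate_le[OF assms])

text \<open>An orbit-stabilizer count for the powers of \<open>c\<close> acting on \<open>y\<close>
  by conjugation: the stabilizer is generated by \<open>c [^] p\<close>, which has index
  \<open>p\<close> since \<open>p\<close> divides \<open>ord c\<close>.\<close>

lemma card_conjugates:
  assumes c: "c \<in> carrier G" and y: "y \<in> carrier G" and p: "p > 0" "p dvd ord c"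
    and stab: "group_centralizer G {c, y} = generate G {c [^] p}"
  shows "card ((\<lambda>s. inv s \<otimes> y \<otimes> s) ` generate G {c}) = p"
proof -
  \<comment> \<open>Integer exponents make the difference \<open>m - n\<close> available for all
    \<open>n\<close> and \<open>m\<close>, and match the description of a cyclic group by
    \<open>generate_pow\<close>.\<close>
  define f where "f n = inv (c [^] n) \<otimes> y \<otimes> c [^] n" for n :: int
  have mem: "c [^] d \<in> generate G {c [^] p} \<longleftrightarrow> int p dvd d" for d :: int
  proof -
    have "c [^] d \<in> generate G {c [^] p} \<longleftrightarrow> (\<exists>j::int. c [^] d = (c [^] int p) [^] j)"
      using c by (auto simp: generate_pow int_pow_int)
    also have "\<dots> \<longleftrightarrow> (\<exists>j::int. int (ord c) dvd int p * j - d)"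
      using c by (simp add: int_pow_pow int_pow_eq)
    also have "\<dots> \<longleftrightarrow> int p dvd d"
    proof
      assume "\<exists>j::int. int (ord c) dvd int p * j - d"
      then obtain j where "int (ord c) dvd int p * j - d"
        by blast
      \<comment> \<open>Exponents matter only modulo \<open>ord c\<close>. As \<open>p\<close>
        divides \<open>ord c\<close>, being a multiple of \<open>p\<close> does not depend on the
        chosen representative.\<close>
      with p(2) have "int p dvd int p * j - d"
        by (meson dvd_trans int_dvd_int_iff)
      then show "int p dvd d"
        by (metis dvd_diff_right_iff dvd_triv_left)
    next
      assume "int p dvd d"
      then obtain j where "d = int p * j" ..
      then show "\<exists>j::int. int (ord c) dvd int p * j - d"
        by (intro exI[of _ j]) simp
    qed
    finally show ?thesis .
  qed
  have f_eq: "f n = f m \<longleftrightarrow> int p dvd m - n" for n m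
  proof -
    have "f n = f m \<longleftrightarrow> c [^] (m - n) \<otimes> y = y \<otimes> c [^] (m - n)"
      unfolding f_def using c y by (simp add: conjugate_eq_iff int_pow_diff)
    \<comment> \<open>A power of \<open>c\<close> commutes with \<open>c\<close> anyway, so
      commuting with \<open>y\<close> is the only condition left.\<close>
    also have "\<dots> \<longleftrightarrow> c [^] (m - n) \<in> group_centralizer G {c, y}"
      using c by (auto simp: group_centralizer_def intro!: commutes_generate[symmetric, of _ "{c}"])
        (auto simp: generate_pow)
    finally show ?thesis
      by (simp add: stab mem)
  qed
  have "(\<lambda>s. inv s \<otimes> y \<otimes> s) ` generate G {c} = range f"
    using c by (auto simp: generate_pow f_def)
  \<comment> \<open>By \<open>f_eq\<close>, \<open>f\<close> depends exactly on the residue modulo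
    \<open>p\<close>; the residues from 0 to \<open>p - 1\<close> represent each value once.\<close>
  also have "\<dots> = f ` {0..<int p}"
  proof -
    have "f n = f (n mod int p)" for n
      by (simp add: f_eq mod_eq_dvd_iff[symmetric])
    moreover have "n mod int p \<in> {0..<int p}" for n
      using p(1) by simp
    ultimately show ?thesis
      by blast
  qed
  also have "card \<dots> = card {0..<int p}"
  proof (rule card_image, rule inj_onI)
    fix n m assume nm: "n \<in> {0..<int p}" "m \<in> {0..<int p}" "f n = f m"
    then have "m mod int p = n mod int p"
      by (simp only: f_eq mod_eq_dvd_iff)
    with nm show "n = m"
      by simp
  qed
  finally show ?thesis
    by simp
qed

end

section \<open>The symmetric group on the darts and its standard cycle\<close>

lemma group_dart_group: "group (dart_group k)"
proof (rule groupI)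
  fix f assume "f \<in> carrier (dart_group k)"
  then show "\<exists>g\<in>carrier (dart_group k). g \<otimes>\<^bsub>dart_group k\<^esub> f = \<one>\<^bsub>dart_group k\<^esub>"
    \<comment> \<open>A permutation of the darts is a bijection of all of \<open>nat\<close> fixing
      everything else, so its inverse is taken over \<open>UNIV\<close>.\<close>
    by (intro bexI[of _ "inv_into UNIV f"])
      (auto simp: dart_group_def permutes_inv permutes_inv_o)
qed (auto simp: dart_group_def permutes_compose permutes_id comp_assoc)

lemma dart_group_simps:
  "f \<in> carrier (dart_group k) \<longleftrightarrow> f permutes darts k"
  "f \<otimes>\<^bsub>dart_group k\<^esub> g = f \<circ> g"
  "\<one>\<^bsub>dart_group k\<^esub> = id"
  by (auto simp: dart_group_def)

lemma dart_group_nat_pow: "f [^]\<^bsub>dart_group k\<^esub> (n::nat) = f ^^ n"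
proof (induction n)
  case (Suc n)
  interpret group "dart_group k" by (rule group_dart_group)
  show ?case
    using Suc by (simp add: dart_group_simps funpow_swap1 fun_eq_iff)
qed (simp add: dart_group_simps)

lemma std_cycle_in_dart_group: "std_cycle k \<in> carrier (dart_group k)"
  by (simp add: dart_group_simps std_cycle_permutes)

lemma ord_std_cycle:
  assumes "k \<ge> 1"
  shows "group.ord (dart_group k) (std_cycle k) = 2 * k"
proof -
  interpret group "dart_group k" by (rule group_dart_group)
  have "std_cycle k ^^ n = id \<longleftrightarrow> 2 * k dvd n" for n
  proof
    assume "std_cycle k ^^ n = id"
    \<comment> \<open>Since \<open>k \<ge> 1\<close>, 0 is a dart, and the power sends it to
      \<open>n mod (2 * k)\<close>. This one value detects the exponent.\<close>
    then have "(std_cycle k ^^ n) 0 = 0"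
      by simp
    then show "2 * k dvd n"
      using assms by (simp add: std_cycle_funpow_apply mod_eq_0_iff_dvd)
  next
    assume dvd: "2 * k dvd n"
    show "std_cycle k ^^ n = id"
    proof
      fix i
      show "(std_cycle k ^^ n) i = id i"
      proof (cases "i < 2 * k")
        case True
        with dvd show ?thesis
          by (auto simp: std_cycle_funpow_apply)
      next
        case False
        with permutes_funpow[OF std_cycle_permutes[of k], of n] show ?thesis
          by (simp add: permutes_not_in)
      qed
    qed
  qed
  then have "2 * k dvd n \<longleftrightarrow> ord (std_cycle k) dvd n" for n
    using pow_eq_id[OF std_cycle_in_dart_group, of n]
    by (simp add: dart_group_nat_pow dart_group_simps)
  \<comment> \<open>Two natural numbers with the same multiples divide each other, hence are
    equal.\<close>
  then show ?thesis
    by (meson dvd_antisym dvd_refl)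
qed

text \<open>Dart \<open>i\<close> is the \<open>i\<close>-th iterate of the cycle at 0, so a
  commuting \<open>g\<close> is determined by \<open>g 0\<close>. It sends \<open>i\<close> to
  \<open>i + g 0\<close> modulo \<open>2 * k\<close>, which makes it the power with exponent
  \<open>g 0\<close>.\<close>

lemma centralizer_std_cycle:
  "group_centralizer (dart_group k) {std_cycle k} = generate (dart_group k) {std_cycle k}"
proof
  interpret group "dart_group k" by (rule group_dart_group)
  let ?c = "std_cycle k"
  note c = std_cycle_in_dart_group[of k]
  show "generate (dart_group k) {?c} \<subseteq> group_centralizer (dart_group k) {?c}"
    using commutes_generate[of ?c "{?c}"] generate_in_carrier[of "{?c}"] c
    by (auto simp: group_centralizer_def)
  show "group_centralizer (dart_group k) {?c} \<subseteq> generate (dart_group k) {?c}"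
  proof
    fix g assume "g \<in> group_centralizer (dart_group k) {?c}"
    then have g: "g permutes darts k" and comm: "g (?c i) = ?c (g i)" for i
      by (auto simp: group_centralizer_def dart_group_simps fun_eq_iff)
    have comm_pow: "g ((?c ^^ n) i) = (?c ^^ n) (g i)" for n i
      by (induction n) (simp_all add: comm)
    have "g i = (?c ^^ g 0) i" for i
    proof (cases "i < 2 * k")
      case True
      then have g0: "g 0 < 2 * k"
        using permutes_in_image[OF g, of 0] by simp
      have "g i = g ((?c ^^ i) 0)"
        using True by (simp add: std_cycle_funpow_apply)
      also have "\<dots> = (?c ^^ i) (g 0)"
        by (rule comm_pow)
      also have "\<dots> = (?c ^^ g 0) i"
        using True g0 by (simp add: std_cycle_funpow_apply add.commute)
      finally show ?thesis .
    next
      case False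
      with g permutes_funpow[OF std_cycle_permutes[of k], of "g 0"] show ?thesis
        by (simp add: permutes_not_in)
    qed
    then have "g = ?c ^^ g 0"
      by (rule ext)
    then have "g = ?c [^]\<^bsub>dart_group k\<^esub> int (g 0)"
      by (simp only: int_pow_int dart_group_nat_pow)
    then show "g \<in> generate (dart_group k) {?c}"
      using c by (auto simp: generate_pow)
  qed
qed

section \<open>Conjugation of maps and the equivalence relation\<close>

lemma free_involution_conjugate:
  assumes y: "free_involution k y" and s: "s \<in> carrier (dart_group k)"
  shows "free_involution k (inv\<^bsub>dart_group k\<^esub> s \<otimes>\<^bsub>dart_group k\<^esub> y \<otimes>\<^bsub>dart_group k\<^esub> s)"
proof -
  interpret group "dart_group k" by (rule group_dart_group)
  let ?t = "inv\<^bsub>dart_group k\<^esub> s"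
  have yc: "y \<in> carrier (dart_group k)" and yy: "\<And>i. y (y i) = i"
    and ni: "\<And>i. i < 2 * k \<Longrightarrow> y i \<noteq> i"
    using y by (auto simp: free_involution_def fun_eq_iff)
  have st: "s (?t i) = i" "?t (s i) = i" for i
    using r_inv[OF s] l_inv[OF s] by (auto simp: dart_group_simps fun_eq_iff)
  \<comment> \<open>A fixed dart \<open>i\<close> of the conjugate would yield the fixed dart
    \<open>s i\<close> of \<open>y\<close>.\<close>
  have "?t (y (s i)) \<noteq> i" if "i < 2 * k" for i
  proof
    assume "?t (y (s i)) = i"
    then have "y (s i) = s i"
      using st(1) by metis
    moreover have "s i < 2 * k"
      using s that permutes_in_image[of s "darts k" i] by (simp add: dart_group_simps)
    ultimately show False
      using ni by blast
  qed
  moreover have "?t \<otimes>\<^bsub>dart_group k\<^esub> y \<otimes>\<^bsub>dart_group k\<^esub> s \<in> carrier (dart_group k)"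
    using s yc by simp
  ultimately show ?thesis
    unfolding free_involution_def by (auto simp: dart_group_simps(2) fun_eq_iff st yy)
qed

lemma equiv_map_equiv: "equiv (edge_maps k) (map_equiv k)"
proof (rule equivI)
  interpret group "dart_group k" by (rule group_dart_group)
  let ?conj = "\<lambda>s a. inv\<^bsub>dart_group k\<^esub> s \<otimes>\<^bsub>dart_group k\<^esub> a \<otimes>\<^bsub>dart_group k\<^esub> s"
  have carr: "fst m \<in> carrier (dart_group k)" "snd m \<in> carrier (dart_group k)"
    if "m \<in> edge_maps k" for m
    using that by (auto simp: edge_maps_def free_involution_def)
  have conj_inv: "?conj (inv\<^bsub>dart_group k\<^esub> s) (?conj s a) = a"
    if "s \<in> carrier (dart_group k)" "a \<in> carrier (dart_group k)" for s a
    using that by (simp add: m_assoc) (simp add: m_assoc[symmetric])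
  \<comment> \<open>Conjugation in the form \<open>inv s\<close>, \<open>a\<close>, \<open>s\<close>
    is a right action. The witness for transitivity is therefore the product of \<open>s\<close> and
    \<open>t\<close> in this order.\<close>
  have conj_mult: "?conj (s \<otimes>\<^bsub>dart_group k\<^esub> t) a = ?conj t (?conj s a)"
    if "s \<in> carrier (dart_group k)" "t \<in> carrier (dart_group k)" "a \<in> carrier (dart_group k)"
    for s t a
    using that by (simp add: m_assoc inv_mult_group)
  show "map_equiv k \<subseteq> edge_maps k \<times> edge_maps k"
    by (auto simp: map_equiv_def)
  show "refl_on (edge_maps k) (map_equiv k)"
    by (rule refl_onI)
      (auto simp: map_equiv_def dest: carr intro!: bexI[of _ "\<one>\<^bsub>dart_group k\<^esub>"])
  show "sym (map_equiv k)"
  proof (rule symI)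
    fix m1 m2 assume "(m1, m2) \<in> map_equiv k"
    then obtain s where m: "m1 \<in> edge_maps k" "m2 \<in> edge_maps k" and s: "s \<in> carrier (dart_group k)"
      and eq: "?conj s (fst m1) = fst m2" "?conj s (snd m1) = snd m2"
      by (auto simp: map_equiv_def)
    have "?conj (inv\<^bsub>dart_group k\<^esub> s) (fst m2) = fst m1"
      "?conj (inv\<^bsub>dart_group k\<^esub> s) (snd m2) = snd m1"
      using conj_inv s carr[OF m(1)] by (simp_all flip: eq)
    then show "(m2, m1) \<in> map_equiv k"
      using m s unfolding map_equiv_def by blast
  qed
  show "trans (map_equiv k)"
  proof (rule transI)
    fix m1 m2 m3 assume "(m1, m2) \<in> map_equiv k" "(m2, m3) \<in> map_equiv k"
    then obtain s t where m: "m1 \<in> edge_maps k" "m3 \<in> edge_maps k"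
      and s: "s \<in> carrier (dart_group k)" and t: "t \<in> carrier (dart_group k)"
      and eq: "?conj s (fst m1) = fst m2" "?conj s (snd m1) = snd m2"
        "?conj t (fst m2) = fst m3" "?conj t (snd m2) = snd m3"
      by (auto simp: map_equiv_def)
    have "?conj (s \<otimes>\<^bsub>dart_group k\<^esub> t) (fst m1) = fst m3"
      "?conj (s \<otimes>\<^bsub>dart_group k\<^esub> t) (snd m1) = snd m3"
      using carr[OF m(1)] by (simp_all only: conj_mult[OF s t] eq)
    then show "(m1, m3) \<in> map_equiv k"
      using m s t unfolding map_equiv_def by blast
  qed
qed

section \<open>Classes of one-vertex maps with a prescribed automorphism group\<close>

lemma one_vertex_maps_aut_eq:
  "one_vertex_maps_aut k p = {std_cycle k} \<times> {y. free_involution k y \<and>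
    group_centralizer (dart_group k) {std_cycle k, y} =
      generate (dart_group k) {std_cycle k [^]\<^bsub>dart_group k\<^esub> p}}"
proof -
  interpret group "dart_group k" by (rule group_dart_group)
  \<comment> \<open>Replaces the monodromy group by its two generators. Transitivity is already
    absorbed in \<open>one_vertex_maps_eq\<close>.\<close>
  have "map_automorphisms k (std_cycle k, y) = group_centralizer (dart_group k) {std_cycle k, y}"
    if "free_involution k y" for y
    using that std_cycle_in_dart_group[of k] unfolding map_automorphisms_def monodromy_group_def
    by (subst group_centralizer_generate) (auto simp: free_involution_def)
  then show ?thesis
    by (auto simp: one_vertex_maps_aut_def one_vertex_maps_eq)
qed

text \<open>Brings the trace of a class into the form counted by \<open>card_conjugates\<close>. The
  class itself lives in \<open>edge_maps k\<close> and may contain maps whose vertex is a different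
  cycle; the intersection discards these.\<close>

lemma class_Int_one_vertex_maps_aut:
  assumes "(c, y) \<in> one_vertex_maps_aut k p"
  shows "map_equiv k `` {(c, y)} \<inter> one_vertex_maps_aut k p =
    Pair c ` (\<lambda>s. inv\<^bsub>dart_group k\<^esub> s \<otimes>\<^bsub>dart_group k\<^esub> y \<otimes>\<^bsub>dart_group k\<^esub> s) `
      generate (dart_group k) {c}"
    (is "?L = Pair c ` ?conj ` _")
proof -
  interpret group "dart_group k" by (rule group_dart_group)
  have c_eq: "c = std_cycle k" and y: "free_involution k y"
    and cent: "group_centralizer (dart_group k) {c, y} =
      generate (dart_group k) {c [^]\<^bsub>dart_group k\<^esub> p}"
    using assms by (auto simp: one_vertex_maps_aut_eq)
  have c: "c \<in> carrier (dart_group k)" and yc: "y \<in> carrier (dart_group k)"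
    using y by (auto simp: c_eq std_cycle_in_dart_group free_involution_def)
  have maps: "m \<in> edge_maps k" if "m \<in> one_vertex_maps_aut k p" for m
    using that by (auto simp: one_vertex_maps_aut_def one_vertex_maps_def)
  \<comment> \<open>Both maps have the same vertex cycle \<open>c\<close>, so the conjugator must
    centralize \<open>c\<close>; by \<open>centralizer_std_cycle\<close> it is a power of
    \<open>c\<close>.\<close>
  have fix_c: "inv\<^bsub>dart_group k\<^esub> s \<otimes>\<^bsub>dart_group k\<^esub> c \<otimes>\<^bsub>dart_group k\<^esub> s = c \<longleftrightarrow>
      s \<in> generate (dart_group k) {c}" if "s \<in> carrier (dart_group k)" for s
  proof -
    have "inv\<^bsub>dart_group k\<^esub> s \<otimes>\<^bsub>dart_group k\<^esub> c \<otimes>\<^bsub>dart_group k\<^esub> s = c \<longleftrightarrow>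
        c \<otimes>\<^bsub>dart_group k\<^esub> s = s \<otimes>\<^bsub>dart_group k\<^esub> c"
      using that c by (simp add: m_assoc inv_solve_left')
    also have "\<dots> \<longleftrightarrow> s \<in> group_centralizer (dart_group k) {c}"
      using that by (auto simp: group_centralizer_def)
    finally show ?thesis
      by (simp add: c_eq centralizer_std_cycle)
  qed
  \<comment> \<open>Conjugation by powers of \<open>c\<close> stays inside the set: it preserves
    free involutions and leaves the centralizer of the pair unchanged.\<close>
  have conj_mem: "(c, ?conj s) \<in> one_vertex_maps_aut k p" if "s \<in> generate (dart_group k) {c}" for s
  proof -
    have "s \<in> carrier (dart_group k)"
      using that c generate_in_carrier[of "{c}"] by auto
    then show ?thesis
      using free_involution_conjugate[OF y] group_centralizer_conjugate[OF c yc that] cent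
      by (simp add: one_vertex_maps_aut_eq c_eq)
  qed
  show ?thesis
  proof
    show "?L \<subseteq> Pair c ` ?conj ` generate (dart_group k) {c}"
    proof
      fix m assume m: "m \<in> ?L"
      then have "fst m = c"
        by (auto simp: one_vertex_maps_aut_eq c_eq)
      with m obtain s where "s \<in> carrier (dart_group k)" "?conj s = snd m"
        "inv\<^bsub>dart_group k\<^esub> s \<otimes>\<^bsub>dart_group k\<^esub> c \<otimes>\<^bsub>dart_group k\<^esub> s = c"
        by (auto simp: map_equiv_def)
      then have "s \<in> generate (dart_group k) {c}" "m = (c, ?conj s)"
        using fix_c \<open>fst m = c\<close> by (auto simp: prod_eq_iff)
      then show "m \<in> Pair c ` ?conj ` generate (dart_group k) {c}"
        by blast
    qed
    show "Pair c ` ?conj ` generate (dart_group k) {c} \<subseteq> ?L"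
    proof clarify
      fix s assume s: "s \<in> generate (dart_group k) {c}"
      then have sc: "s \<in> carrier (dart_group k)"
        using c generate_in_carrier[of "{c}"] by auto
      have "((c, y), (c, ?conj s)) \<in> map_equiv k"
        unfolding map_equiv_def
        using maps[OF assms] maps[OF conj_mem[OF s]] fix_c[OF sc] s
        by (intro CollectI case_prodI conjI bexI[OF _ sc]) (simp_all only: fst_conv snd_conv)
      with conj_mem[OF s] show "(c, ?conj s) \<in> ?L"
        by blast
    qed
  qed
qed

theorem corollary4p4:
  fixes k p :: nat
  assumes "k \<ge> 1" and "p > 0" and "p dvd 2 * k"
  shows "real (card (one_vertex_maps_aut k p // map_equiv k)) = real (nu k p) / real p"
proof -
  interpret group "dart_group k" by (rule group_dart_group)
  let ?A = "one_vertex_maps_aut k p"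
  have "?A \<subseteq> {std_cycle k} \<times> {f. f permutes darts k}"
    by (auto simp: one_vertex_maps_aut_eq free_involution_def dart_group_simps)
  then have fin: "finite ?A"
    by (rule finite_subset) (simp add: finite_permutations)
  have sub: "?A \<subseteq> edge_maps k"
    by (auto simp: one_vertex_maps_aut_def one_vertex_maps_def)
  have "card (map_equiv k `` {m} \<inter> ?A) = p" if "m \<in> ?A" for m
  proof -
    obtain c y where m: "m = (c, y)"
      by (cases m)
    have cy: "c = std_cycle k" "free_involution k y" "group_centralizer (dart_group k) {c, y} =
        generate (dart_group k) {c [^]\<^bsub>dart_group k\<^esub> p}"
      using that by (auto simp: one_vertex_maps_aut_eq m)
    show ?thesis
      unfolding m class_Int_one_vertex_maps_aut[OF that[unfolded m]]
      using cy assms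
      by (subst card_image)
        (auto simp: inj_on_def free_involution_def std_cycle_in_dart_group ord_std_cycle
          intro!: card_conjugates)
  qed
  from card_eq_mult_card_quotient[OF equiv_map_equiv sub fin this]
  show ?thesis
    using assms by (simp add: nu_def)
qed

end
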